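(* Let $n\geq 2$ be an even integer and let $q\ge 3$ be an integer. If $q$ is odd and each prime factor $p$ of $q$ satisfies $v_p(q) > \log_p \frac{n}{2} + 1$, then $$S_n(q)=\prod_{p\mid q}\left(\binom{n-1}{\frac n2-1}\,\frac{p-1}{p}\,p^{(\frac n2+1)v_p(q)}\right),$$ where the product runs over all prime factors $p$ of $q$.
   Context: For an integer $q\ge 3$, let $\zeta=e^{2\pi i/q}$. For integers $u,v$ the Kloosterman sum is $$K(u,v;q)=\sum_{\substack{0<x\le q\\ (x,q)=1}}\zeta^{ux+v\bar x},$$ where $\bar x$ denotes the multiplicative inverse of $x$ in $(\mathbb{Z}/q\mathbb{Z})^*$. For a positive integer $n$, the $n$-th power moment is $$S_n(q)=\sum_{u=1}^q K(u,1;q)^n.$$ For a prime $p$, $v_p(q)$ denotes the $p$-adic valuation of $q$, and $\log_p$ is the real logarithm to base $p$. *)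

theory Defs
  imports "HOL-Analysis.Analysis" "HOL-Number_Theory.Number_Theory"
begin

definition zeta :: "nat \<Rightarrow> complex" where
  "zeta q = exp (2 * of_real pi * \<i> / of_nat q)"

text \<open>
  The inverse of \<open>x\<close> modulo \<open>q\<close> is represented by its residue in \<open>{0..<q}\<close>; the exponent is an
  integer, so an integer power is used.  The set \<open>totatives q\<close> consists of the \<open>x\<close> with
  \<open>0 < x \<le> q\<close> that are coprime to \<open>q\<close>.
\<close>

definition kloosterman :: "int \<Rightarrow> int \<Rightarrow> nat \<Rightarrow> complex" where
  "kloosterman u v q =
     (\<Sum>x\<in>totatives q. zeta q powi (u * int x + v * modular_inverse (int q) (int x)))"

definition power_moment :: "nat \<Rightarrow> nat \<Rightarrow> complex" where
  "power_moment n q = (\<Sum>u = 1..q. kloosterman (int u) 1 q ^ n)"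

end

theory Submission
  imports Defs
begin

text \<open>
  The moment is multiplicative in \<open>q\<close> (\<open>power_moment_mult\<close>): by the Chinese remainder theorem a
  Kloosterman sum modulo \<open>q\<^sub>1 q\<^sub>2\<close> factors into one modulo \<open>q\<^sub>1\<close> and one modulo \<open>q\<^sub>2\<close>, and
  the two parameters run independently through all residues. So it suffices to treat
  \<open>q = p\<^sup>a\<close> with \<open>p\<close> odd. Write \<open>n = 2 h\<close>; the hypothesis on the valuation then says
  \<open>h < p ^ (a - 1)\<close>, and in particular \<open>a \<ge> 2\<close>.
  
  For such \<open>q\<close> the sum \<open>K(u, 1; q)\<close> can be evaluated by the \<open>p\<close>-adic method of stationary
  phase (\<open>kloosterman_stationary_phase\<close>). With \<open>m = a div 2\<close>, only those \<open>x\<close> with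
  \<open>u x\<^sup>2 \<equiv> 1\<close> modulo \<open>p ^ m\<close> contribute. Hence \<open>K(u, 1; q) = 0\<close> unless \<open>u\<close> is the square
  of a unit \<open>v\<close>, and then the contributing \<open>x\<close> form two opposite branches, which give
  \<open>K(v\<^sup>2, 1; q) = Z(v) + cnj Z(v)\<close> (\<open>kloosterman_square\<close>). Expanding the phase around the
  critical point shows \<open>Z(v) = e(2 v / q) g(v)\<close>, where \<open>g\<close> is a quadratic Gauss sum
  (\<open>branch_eq\<close>). The proof uses two properties of \<open>g\<close>: its absolute value is \<open>sqrt q\<close>, and
  \<open>g(v)\<close> depends only on \<open>v\<close> modulo \<open>p\<close>.
  
  Every square of a unit has exactly two square roots, so \<open>2 S\<^sub>n(q)\<close> is the sum of
  \<open>(Z(v) + cnj Z(v)) ^ n\<close> over all units \<open>v\<close>. In the binomial expansion the \<open>k\<close>-th term is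
  \<open>e(4 (k - h) v / q)\<close> times a function of \<open>v\<close> modulo \<open>p\<close>. The translation \<open>v \<mapsto> v + p\<close>
  multiplies its sum over \<open>v\<close> by a root of unity, which differs from \<open>1\<close> unless \<open>p ^ (a - 1)\<close>
  divides \<open>k - h\<close>. As \<open>\<bar>k - h\<bar> \<le> h < p ^ (a - 1)\<close>, only the middle term \<open>k = h\<close> survives
  (\<open>sum_units_branch_power\<close>). It contributes \<open>(2 h choose h) q ^ h \<phi>(q)\<close>, and
  \<open>2 h choose h = 2 ((2 h - 1) choose (h - 1))\<close> turns half of this into the stated factor.
\<close>

section \<open>Additive characters and sums over residues\<close>

abbreviation echar :: "nat \<Rightarrow> int \<Rightarrow> complex" where
  "echar q k \<equiv> zeta q powi k"

lemma zeta_nonzero [simp]: "zeta q \<noteq> 0"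
  by (simp add: zeta_def)

lemma echar_add: "echar q (j + k) = echar q j * echar q k"
  by (rule power_int_add) simp

lemma echar_cis: "echar q k = cis (2 * pi * of_int k / of_nat q)"
proof -
  have "zeta q = cis (2 * pi / of_nat q)"
    by (simp add: zeta_def cis_conv_exp mult_ac)
  then show ?thesis
    by (simp add: cis_power_int mult_ac)
qed

lemma cnj_echar: "cnj (echar q k) = echar q (- k)"
  by (simp add: echar_cis cis_cnj)

lemma echar_mult_left: "q\<^sub>2 > 0 \<Longrightarrow> echar (q\<^sub>1 * q\<^sub>2) (int q\<^sub>2 * k) = echar q\<^sub>1 k"
  by (simp add: echar_cis mult.assoc)

lemma echar_eq_1_iff:
  assumes "q > 0"
  shows "echar q k = 1 \<longleftrightarrow> int q dvd k"
proof
  assume "echar q k = 1"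
  then have "exp (\<i> * of_real (2 * pi * of_int k / of_nat q)) = 1"
    by (simp add: echar_cis cis_conv_exp)
  then obtain n :: int where "2 * pi * of_int k / of_nat q = of_int (2 * n) * pi"
    unfolding exp_eq_1 by auto
  then have "(of_int k :: real) = of_int (n * int q)"
    using assms by (simp add: field_simps)
  then have "k = n * int q"
    using of_int_eq_iff by blast
  then show "int q dvd k" by simp
next
  assume "int q dvd k"
  then obtain n where "k = int q * n" ..
  then have "echar q k = cis (2 * pi * of_int n)"
    using assms by (simp add: echar_cis mult.assoc)
  then show "echar q k = 1"
    by (simp add: cis_multiple_2pi)
qed

lemma echar_cong:
  assumes "q > 0" "[j = k] (mod int q)"
  shows "echar q j = echar q k"
proof -
  have "echar q (j - k) = 1"
    using assms by (simp add: echar_eq_1_iff cong_iff_dvd_diff)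
  then show ?thesis
    using echar_add[of q "j - k" k] by simp
qed

lemma sum_echar_multiples:
  assumes "N > 0" "q > 0" "int q dvd N * k"
  shows "(\<Sum>t\<in>{0..<N}. echar q (t * k)) = (if int q dvd k then of_int N else 0)"
proof (cases "int q dvd k")
  case True
  then have "echar q (t * k) = 1" for t
    using assms(2) by (simp add: echar_eq_1_iff)
  then show ?thesis
    using True assms(1) by simp
next
  case False
  have "(\<Sum>t\<in>{0..<N}. echar q (t * k)) = (\<Sum>t<nat N. echar q (int t * k))"
    by (rule sum.reindex_bij_witness[of _ int nat]) (use assms in auto)
  also have "\<dots> = (\<Sum>t<nat N. (echar q k) ^ t)"
    by (simp add: power_int_power' mult.commute)
  also have "\<dots> = 0"
  proof -
    have "(echar q k) ^ nat N = 1"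
      using assms by (simp add: power_int_power' echar_eq_1_iff mult.commute)
    moreover have "echar q k \<noteq> 1"
      using False assms(2) by (simp add: echar_eq_1_iff)
    ultimately show ?thesis
      using geometric_sum[of "echar q k" "nat N"] by simp
  qed
  finally show ?thesis
    using False by simp
qed

text \<open>
  Residues are taken in \<open>{0..<q}\<close>, the range of \<open>mod\<close>, so that maps can be reduced modulo \<open>q\<close>
  without a case distinction.
\<close>

definition units :: "nat \<Rightarrow> int set" where
  "units q = {x \<in> {0..<int q}. coprime x (int q)}"

lemma finite_units [simp]: "finite (units q)"
  by (rule finite_subset[of _ "{0..<int q}"]) (auto simp: units_def)

lemma units_coprime: "x \<in> units q \<Longrightarrow> coprime x (int q)"
  by (simp add: units_def)

lemma mod_in_units: "q > 0 \<Longrightarrow> coprime x (int q) \<Longrightarrow> x mod int q \<in> units q"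
  by (simp add: units_def coprime_mod_left_iff)

lemma units_eqI: "x \<in> units q \<Longrightarrow> y \<in> units q \<Longrightarrow> [x = y] (mod int q) \<Longrightarrow> x = y"
  by (simp add: units_def cong_def)

lemma bij_betw_totatives_units:
  assumes "q > 0"
  shows "bij_betw (\<lambda>x. int x mod int q) (totatives q) (units q)"
proof (rule bij_betw_byWitness[where f' = "\<lambda>y. if y = 0 then q else nat y"])
  show "\<forall>x\<in>totatives q. (if int x mod int q = 0 then q else nat (int x mod int q)) = x"
  proof
    fix x assume "x \<in> totatives q"
    then have "x = q \<or> 0 < x \<and> x < q"
      by (auto simp: totatives_def)
    then show "(if int x mod int q = 0 then q else nat (int x mod int q)) = x"
      by (auto dest: nat_dvd_not_less)
  qed
qed (use assms in \<open>auto simp: units_def totatives_def coprime_mod_left_iff simp flip: coprime_int_iff\<close>)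

lemma card_units: "card (units q) = totient q"
proof (cases "q > 0")
  case True
  then show ?thesis
    using bij_betw_same_card[OF bij_betw_totatives_units] by (simp add: totient_def)
next
  case False
  then have "units q = {}" by (auto simp: units_def)
  then show ?thesis using False by simp
qed

lemma modular_inverse_cong:
  fixes x w m :: int
  assumes "[x * w = 1] (mod m)"
  shows "[modular_inverse m x = w] (mod m)"
proof -
  have "coprime x m"
    using assms coprime_iff_invertible_int by blast
  have "[modular_inverse m x * 1 = modular_inverse m x * (x * w)] (mod m)"
    by (rule cong_sym, intro cong_mult assms cong_refl)
  also have "modular_inverse m x * (x * w) = (modular_inverse m x * x) * w"
    by (simp add: mult_ac)
  also have "[\<dots> = 1 * w] (mod m)"
    using \<open>coprime x m\<close> by (intro cong_mult cong_refl cong_modular_inverse2)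
  finally show ?thesis by simp
qed

lemma modular_inverse_cong_arg:
  fixes x y m :: int
  assumes "coprime x m" "[x = y] (mod m)"
  shows "[modular_inverse m x = modular_inverse m y] (mod m)"
proof (rule modular_inverse_cong)
  have "coprime y m"
    using assms cong_imp_coprime by blast
  then show "[x * modular_inverse m y = 1] (mod m)"
    using cong_trans[OF cong_mult[OF assms(2) cong_refl] cong_modular_inverse1] by blast
qed

text \<open>
  Every change of variable on the units below (scaling by a unit, negation, translation by a
  prime divisor of \<open>q\<close>) is an instance of this rule: an injective self-map of a finite set is a
  permutation. Periodicity is asked only at arguments prime to \<open>q\<close>, where taking modular inverses
  respects congruence.
\<close>

lemma sum_units_reindex:
  fixes f :: "int \<Rightarrow> complex" and g :: "int \<Rightarrow> int"
  assumes "q > 0"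
    and periodic: "\<And>x y. coprime x (int q) \<Longrightarrow> [x = y] (mod int q) \<Longrightarrow> f x = f y"
    and coprime: "\<And>x. coprime x (int q) \<Longrightarrow> coprime (g x) (int q)"
    and inj: "\<And>x y. coprime x (int q) \<Longrightarrow> coprime y (int q) \<Longrightarrow>
                [g x = g y] (mod int q) \<Longrightarrow> [x = y] (mod int q)"
  shows "(\<Sum>x\<in>units q. f (g x)) = (\<Sum>x\<in>units q. f x)"
proof -
  have inj': "inj_on (\<lambda>x. g x mod int q) (units q)"
    by (rule inj_onI) (use inj units_coprime in \<open>auto intro!: units_eqI simp: cong_def\<close>)
  have "(\<lambda>x. g x mod int q) ` units q = units q"
    using inj' assms(1) coprime
    by (intro endo_inj_surj) (auto intro!: mod_in_units dest: units_coprime)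
  then have "bij_betw (\<lambda>x. g x mod int q) (units q) (units q)"
    using inj' by (simp add: bij_betw_def)
  then have "(\<Sum>x\<in>units q. f (g x mod int q)) = (\<Sum>x\<in>units q. f x)"
    by (rule sum.reindex_bij_betw)
  moreover have "f (g x mod int q) = f (g x)" if "x \<in> units q" for x
    using that units_coprime coprime periodic[of "g x" "g x mod int q"] by (simp add: cong_def)
  ultimately show ?thesis by simp
qed

section \<open>Kloosterman sums over units\<close>

definition kloosterman_term :: "nat \<Rightarrow> int \<Rightarrow> int \<Rightarrow> int \<Rightarrow> complex" where
  "kloosterman_term q u v x = echar q (u * x + v * modular_inverse (int q) x)"

lemma kloosterman_term_cong:
  assumes "q > 0" "coprime x (int q)" "[x = y] (mod int q)"
  shows "kloosterman_term q u v x = kloosterman_term q u v y"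
  unfolding kloosterman_term_def
  by (intro echar_cong cong_add cong_mult cong_refl modular_inverse_cong_arg assms)

text \<open>
  The exponent depends only on the class of the inverse, so any explicit inverse \<open>w\<close> of \<open>x\<close> may be
  used in the place of the canonical representative. This is how all terms are evaluated below.
\<close>

lemma kloosterman_term_witness:
  assumes "q > 0" "[x * w = 1] (mod int q)"
  shows "kloosterman_term q u v x = echar q (u * x + v * w)"
  unfolding kloosterman_term_def
  by (intro echar_cong cong_add cong_mult cong_refl modular_inverse_cong assms)

lemma kloosterman_eq_sum_units:
  assumes "q > 0"
  shows "kloosterman u v q = (\<Sum>x\<in>units q. kloosterman_term q u v x)"
proof -
  have "kloosterman u v q = (\<Sum>x\<in>totatives q. kloosterman_term q u v (int x mod int q))"
    unfolding kloosterman_def kloosterman_term_def[symmetric]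
    by (intro sum.cong kloosterman_term_cong) (use assms in \<open>auto simp: totatives_def cong_def\<close>)
  also have "\<dots> = (\<Sum>x\<in>units q. kloosterman_term q u v x)"
    by (rule sum.reindex_bij_betw[OF bij_betw_totatives_units[OF assms]])
  finally show ?thesis .
qed

lemma kloosterman_cong:
  assumes "q > 0" "[u = u'] (mod int q)"
  shows "kloosterman u v q = kloosterman u' v q"
  unfolding kloosterman_def
  by (intro sum.cong refl echar_cong cong_add cong_mult cong_refl assms)

lemma power_moment_residues:
  assumes "q > 0"
  shows "power_moment n q = (\<Sum>u\<in>{0..<int q}. kloosterman u 1 q ^ n)"
proof -
  have "power_moment n q = (\<Sum>u = 1..q. kloosterman (int u mod int q) 1 q ^ n)"
    unfolding power_moment_def
    by (intro sum.cong refl arg_cong[where f = "\<lambda>z. z ^ n"] kloosterman_cong)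
       (use assms in \<open>auto simp: cong_def\<close>)
  also have "\<dots> = (\<Sum>u\<in>{0..<int q}. kloosterman u 1 q ^ n)"
  proof (rule sum.reindex_bij_witness[where i = "\<lambda>u. if u = 0 then q else nat u"])
    fix u assume "u \<in> {1..q}"
    then show "(if int u mod int q = 0 then q else nat (int u mod int q)) = u"
      by (cases "u = q") auto
  qed (use assms in auto)
  finally show ?thesis .
qed

section \<open>Multiplicativity of the moments\<close>

text \<open>
  The Chinese remainder isomorphism, twisted by \<open>q\<^sub>2\<close> and \<open>q\<^sub>1\<close>. The twist absorbs the factors
  that appear in \<open>e(k\<^sub>1 / q\<^sub>1) e(k\<^sub>2 / q\<^sub>2) = e((q\<^sub>2 k\<^sub>1 + q\<^sub>1 k\<^sub>2) / (q\<^sub>1 q\<^sub>2))\<close>, so that the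
  coefficient of the inverse stays equal to \<open>1\<close> in both components.
\<close>

lemma bij_betw_units_mult:
  assumes "q\<^sub>1 > 0" "q\<^sub>2 > 0" "coprime q\<^sub>1 q\<^sub>2"
  shows "bij_betw (\<lambda>x. (int q\<^sub>2 * x mod int q\<^sub>1, int q\<^sub>1 * x mod int q\<^sub>2))
           (units (q\<^sub>1 * q\<^sub>2)) (units q\<^sub>1 \<times> units q\<^sub>2)"
proof -
  let ?f = "\<lambda>x. (int q\<^sub>2 * x mod int q\<^sub>1, int q\<^sub>1 * x mod int q\<^sub>2)"
  have cop: "coprime (int q\<^sub>1) (int q\<^sub>2)" "coprime (int q\<^sub>2) (int q\<^sub>1)"
    using assms(3) by (simp_all add: coprime_commute)
  have inj: "inj_on ?f (units (q\<^sub>1 * q\<^sub>2))"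
  proof (rule inj_onI)
    fix x y assume xy: "x \<in> units (q\<^sub>1 * q\<^sub>2)" "y \<in> units (q\<^sub>1 * q\<^sub>2)" "?f x = ?f y"
    then have "[int q\<^sub>2 * x = int q\<^sub>2 * y] (mod int q\<^sub>1)" "[int q\<^sub>1 * x = int q\<^sub>1 * y] (mod int q\<^sub>2)"
      by (auto simp: cong_def)
    then have "[x = y] (mod int q\<^sub>1)" "[x = y] (mod int q\<^sub>2)"
      using cop by (auto simp: cong_mult_lcancel)
    then have "[x = y] (mod int q\<^sub>1 * int q\<^sub>2)"
      using cop by (simp add: coprime_cong_mult)
    then show "x = y"
      using xy by (intro units_eqI) auto
  qed
  have "?f ` units (q\<^sub>1 * q\<^sub>2) = units q\<^sub>1 \<times> units q\<^sub>2"
  proof (rule card_subset_eq)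
    show "?f ` units (q\<^sub>1 * q\<^sub>2) \<subseteq> units q\<^sub>1 \<times> units q\<^sub>2"
      using assms(1,2) cop by (auto intro!: mod_in_units dest: units_coprime)
    show "card (?f ` units (q\<^sub>1 * q\<^sub>2)) = card (units q\<^sub>1 \<times> units q\<^sub>2)"
      using assms(3) by (simp add: card_image[OF inj] card_units card_cartesian_product totient_mult_coprime)
  qed simp
  with inj show ?thesis by (simp add: bij_betw_def)
qed

lemma bij_betw_residues_mult:
  assumes "q\<^sub>1 > 0" "q\<^sub>2 > 0" "coprime q\<^sub>1 q\<^sub>2"
  shows "bij_betw (\<lambda>(u\<^sub>1, u\<^sub>2). (int q\<^sub>2 ^ 2 * u\<^sub>1 + int q\<^sub>1 ^ 2 * u\<^sub>2) mod int (q\<^sub>1 * q\<^sub>2))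
           ({0..<int q\<^sub>1} \<times> {0..<int q\<^sub>2}) {0..<int (q\<^sub>1 * q\<^sub>2)}"
proof -
  let ?h = "\<lambda>u\<^sub>1 u\<^sub>2. int q\<^sub>2 ^ 2 * u\<^sub>1 + int q\<^sub>1 ^ 2 * u\<^sub>2"
  let ?f = "\<lambda>(u\<^sub>1, u\<^sub>2). ?h u\<^sub>1 u\<^sub>2 mod int (q\<^sub>1 * q\<^sub>2)"
  have cop: "coprime (int q\<^sub>1) (int q\<^sub>2)" "coprime (int q\<^sub>2) (int q\<^sub>1)"
    using assms(3) by (simp_all add: coprime_commute)
  have inj: "inj_on ?f ({0..<int q\<^sub>1} \<times> {0..<int q\<^sub>2})"
  proof (rule inj_onI, clarify)
    fix a b c d :: int
    assume A: "a \<in> {0..<int q\<^sub>1}" "b \<in> {0..<int q\<^sub>2}" "c \<in> {0..<int q\<^sub>1}" "d \<in> {0..<int q\<^sub>2}"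
      and "?h a b mod int (q\<^sub>1 * q\<^sub>2) = ?h c d mod int (q\<^sub>1 * q\<^sub>2)"
    then have *: "[?h a b = ?h c d] (mod int (q\<^sub>1 * q\<^sub>2))"
      by (simp add: cong_def)
    have "[?h a b = ?h c d] (mod int q\<^sub>1)" "[?h a b = ?h c d] (mod int q\<^sub>2)"
      by (rule cong_dvd_modulus[OF *]; simp)+
    moreover have "[int q\<^sub>2 ^ 2 * u = ?h u v] (mod int q\<^sub>1)" "[int q\<^sub>1 ^ 2 * v = ?h u v] (mod int q\<^sub>2)" for u v
      by (simp_all add: cong_iff_dvd_diff power2_eq_square)
    ultimately have "[int q\<^sub>2 ^ 2 * a = int q\<^sub>2 ^ 2 * c] (mod int q\<^sub>1)"
        "[int q\<^sub>1 ^ 2 * b = int q\<^sub>1 ^ 2 * d] (mod int q\<^sub>2)"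
      by (meson cong_trans cong_sym)+
    then have "[a = c] (mod int q\<^sub>1)" "[b = d] (mod int q\<^sub>2)"
      using cop by (auto simp: cong_mult_lcancel)
    with A show "a = c \<and> b = d"
      by (auto simp: cong_def)
  qed
  have "?f ` ({0..<int q\<^sub>1} \<times> {0..<int q\<^sub>2}) = {0..<int (q\<^sub>1 * q\<^sub>2)}"
  proof (rule card_subset_eq)
    show "?f ` ({0..<int q\<^sub>1} \<times> {0..<int q\<^sub>2}) \<subseteq> {0..<int (q\<^sub>1 * q\<^sub>2)}"
    proof clarify
      fix a b :: int
      have "int (q\<^sub>1 * q\<^sub>2) > 0" using assms(1,2) by simp
      then show "?h a b mod int (q\<^sub>1 * q\<^sub>2) \<in> {0..<int (q\<^sub>1 * q\<^sub>2)}"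
        by (simp only: atLeastLessThan_iff pos_mod_sign pos_mod_bound conj_absorb simp_thms)
    qed
    show "card (?f ` ({0..<int q\<^sub>1} \<times> {0..<int q\<^sub>2})) = card {0..<int (q\<^sub>1 * q\<^sub>2)}"
      by (subst card_image[OF inj]) (simp add: card_cartesian_product nat_mult_distrib)
  qed simp
  with inj show ?thesis by (simp add: bij_betw_def)
qed

text \<open>
  If \<open>w\<^sub>1\<close> and \<open>w\<^sub>2\<close> invert the components \<open>q\<^sub>2 x\<close> and \<open>q\<^sub>1 x\<close>, then \<open>q\<^sub>2 w\<^sub>1 + q\<^sub>1 w\<^sub>2\<close> inverts \<open>x\<close>
  modulo \<open>q\<^sub>1 q\<^sub>2\<close>; and modulo \<open>q\<^sub>1\<close> one has \<open>(q\<^sub>2\<^sup>2 u\<^sub>1 + q\<^sub>1\<^sup>2 u\<^sub>2) x \<equiv> q\<^sub>2 u\<^sub>1 (q\<^sub>2 x)\<close>, which explains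
  the squares in the parameter.
\<close>

lemma kloosterman_mult:
  assumes "q\<^sub>1 > 0" "q\<^sub>2 > 0" "coprime q\<^sub>1 q\<^sub>2"
  shows "kloosterman (int q\<^sub>2 ^ 2 * u\<^sub>1 + int q\<^sub>1 ^ 2 * u\<^sub>2) 1 (q\<^sub>1 * q\<^sub>2) =
           kloosterman u\<^sub>1 1 q\<^sub>1 * kloosterman u\<^sub>2 1 q\<^sub>2"
proof -
  have cop: "coprime (int q\<^sub>1) (int q\<^sub>2)" "coprime (int q\<^sub>2) (int q\<^sub>1)"
    using assms(3) by (simp_all add: coprime_commute)
  let ?q = "q\<^sub>1 * q\<^sub>2"
  have split: "kloosterman_term ?q (int q\<^sub>2 ^ 2 * u\<^sub>1 + int q\<^sub>1 ^ 2 * u\<^sub>2) 1 x =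
      kloosterman_term q\<^sub>1 u\<^sub>1 1 (int q\<^sub>2 * x mod int q\<^sub>1) * kloosterman_term q\<^sub>2 u\<^sub>2 1 (int q\<^sub>1 * x mod int q\<^sub>2)"
    if "x \<in> units ?q" for x
  proof -
    have cx: "coprime x (int q\<^sub>1)" "coprime x (int q\<^sub>2)"
      using units_coprime[OF that] by auto
    define w\<^sub>1 where "w\<^sub>1 = modular_inverse (int q\<^sub>1) (int q\<^sub>2 * x)"
    define w\<^sub>2 where "w\<^sub>2 = modular_inverse (int q\<^sub>2) (int q\<^sub>1 * x)"
    have w: "[(int q\<^sub>2 * x) * w\<^sub>1 = 1] (mod int q\<^sub>1)" "[(int q\<^sub>1 * x) * w\<^sub>2 = 1] (mod int q\<^sub>2)"
      unfolding w\<^sub>1_def w\<^sub>2_def using cx cop by (auto intro!: cong_modular_inverse1)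
    have "[x * (int q\<^sub>2 * w\<^sub>1 + int q\<^sub>1 * w\<^sub>2) = (int q\<^sub>2 * x) * w\<^sub>1] (mod int q\<^sub>1)"
         "[x * (int q\<^sub>2 * w\<^sub>1 + int q\<^sub>1 * w\<^sub>2) = (int q\<^sub>1 * x) * w\<^sub>2] (mod int q\<^sub>2)"
      by (simp_all add: cong_iff_dvd_diff algebra_simps)
    then have "[x * (int q\<^sub>2 * w\<^sub>1 + int q\<^sub>1 * w\<^sub>2) = 1] (mod int q\<^sub>1)"
              "[x * (int q\<^sub>2 * w\<^sub>1 + int q\<^sub>1 * w\<^sub>2) = 1] (mod int q\<^sub>2)"
      using w cong_trans by blast+
    then have "[x * (int q\<^sub>2 * w\<^sub>1 + int q\<^sub>1 * w\<^sub>2) = 1] (mod int ?q)"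
      using cop by (simp add: coprime_cong_mult)
    then have "kloosterman_term ?q (int q\<^sub>2 ^ 2 * u\<^sub>1 + int q\<^sub>1 ^ 2 * u\<^sub>2) 1 x =
        echar ?q ((int q\<^sub>2 ^ 2 * u\<^sub>1 + int q\<^sub>1 ^ 2 * u\<^sub>2) * x + 1 * (int q\<^sub>2 * w\<^sub>1 + int q\<^sub>1 * w\<^sub>2))"
      using assms(1,2) by (intro kloosterman_term_witness) auto
    also have "\<dots> = echar ?q (int q\<^sub>2 * (u\<^sub>1 * (int q\<^sub>2 * x) + w\<^sub>1) + int q\<^sub>1 * (u\<^sub>2 * (int q\<^sub>1 * x) + w\<^sub>2))"
      by (simp add: algebra_simps power2_eq_square)
    also have "\<dots> = echar q\<^sub>1 (u\<^sub>1 * (int q\<^sub>2 * x) + w\<^sub>1) * echar q\<^sub>2 (u\<^sub>2 * (int q\<^sub>1 * x) + w\<^sub>2)"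
      using echar_mult_left[OF assms(2), of q\<^sub>1] echar_mult_left[OF assms(1), of q\<^sub>2]
      by (simp only: echar_add[of ?q] mult.commute[of q\<^sub>2 q\<^sub>1])
    also have "\<dots> = kloosterman_term q\<^sub>1 u\<^sub>1 1 (int q\<^sub>2 * x) * kloosterman_term q\<^sub>2 u\<^sub>2 1 (int q\<^sub>1 * x)"
      by (simp add: kloosterman_term_def w\<^sub>1_def w\<^sub>2_def)
    also have "\<dots> = kloosterman_term q\<^sub>1 u\<^sub>1 1 (int q\<^sub>2 * x mod int q\<^sub>1) *
                      kloosterman_term q\<^sub>2 u\<^sub>2 1 (int q\<^sub>1 * x mod int q\<^sub>2)"
      by (intro arg_cong2[where f = "(*)"] kloosterman_term_cong) (use assms cx cop in \<open>auto simp: cong_def\<close>)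
    finally show ?thesis .
  qed
  have "kloosterman (int q\<^sub>2 ^ 2 * u\<^sub>1 + int q\<^sub>1 ^ 2 * u\<^sub>2) 1 ?q =
     (\<Sum>x\<in>units ?q. kloosterman_term q\<^sub>1 u\<^sub>1 1 (int q\<^sub>2 * x mod int q\<^sub>1) *
        kloosterman_term q\<^sub>2 u\<^sub>2 1 (int q\<^sub>1 * x mod int q\<^sub>2))"
    using assms(1,2) split by (simp add: kloosterman_eq_sum_units)
  also have "\<dots> = (\<Sum>(x, y)\<in>units q\<^sub>1 \<times> units q\<^sub>2. kloosterman_term q\<^sub>1 u\<^sub>1 1 x * kloosterman_term q\<^sub>2 u\<^sub>2 1 y)"
    using sum.reindex_bij_betw[OF bij_betw_units_mult[OF assms],
      of "\<lambda>(x, y). kloosterman_term q\<^sub>1 u\<^sub>1 1 x * kloosterman_term q\<^sub>2 u\<^sub>2 1 y"] by simp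
  also have "\<dots> = kloosterman u\<^sub>1 1 q\<^sub>1 * kloosterman u\<^sub>2 1 q\<^sub>2"
    using assms(1,2) by (simp add: kloosterman_eq_sum_units sum_product sum.cartesian_product)
  finally show ?thesis .
qed

lemma power_moment_mult:
  assumes "q\<^sub>1 > 0" "q\<^sub>2 > 0" "coprime q\<^sub>1 q\<^sub>2"
  shows "power_moment n (q\<^sub>1 * q\<^sub>2) = power_moment n q\<^sub>1 * power_moment n q\<^sub>2"
proof -
  let ?q = "q\<^sub>1 * q\<^sub>2" and ?h = "\<lambda>u\<^sub>1 u\<^sub>2. int q\<^sub>2 ^ 2 * u\<^sub>1 + int q\<^sub>1 ^ 2 * u\<^sub>2"
  have q: "?q > 0" using assms(1,2) by simp
  have "power_moment n ?q = (\<Sum>u\<in>{0..<int ?q}. kloosterman u 1 ?q ^ n)"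
    by (rule power_moment_residues[OF q])
  also have "\<dots> = (\<Sum>(u\<^sub>1, u\<^sub>2)\<in>{0..<int q\<^sub>1} \<times> {0..<int q\<^sub>2}. kloosterman (?h u\<^sub>1 u\<^sub>2 mod int ?q) 1 ?q ^ n)"
    by (subst sum.reindex_bij_betw[OF bij_betw_residues_mult[OF assms], symmetric])
       (simp only: case_prod_unfold)
  also have "\<dots> = (\<Sum>(u\<^sub>1, u\<^sub>2)\<in>{0..<int q\<^sub>1} \<times> {0..<int q\<^sub>2}.
      kloosterman u\<^sub>1 1 q\<^sub>1 ^ n * kloosterman u\<^sub>2 1 q\<^sub>2 ^ n)"
  proof (intro sum.cong refl, clarify)
    fix u\<^sub>1 u\<^sub>2 :: int
    have "kloosterman (?h u\<^sub>1 u\<^sub>2 mod int ?q) 1 ?q = kloosterman (?h u\<^sub>1 u\<^sub>2) 1 ?q"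
      by (rule kloosterman_cong[OF q]) (simp add: cong_def)
    then show "kloosterman (?h u\<^sub>1 u\<^sub>2 mod int ?q) 1 ?q ^ n =
        kloosterman u\<^sub>1 1 q\<^sub>1 ^ n * kloosterman u\<^sub>2 1 q\<^sub>2 ^ n"
      by (simp only: kloosterman_mult[OF assms] power_mult_distrib)
  qed
  also have "\<dots> = power_moment n q\<^sub>1 * power_moment n q\<^sub>2"
    using assms(1,2) by (simp add: power_moment_residues sum_product sum.cartesian_product)
  finally show ?thesis .
qed

lemma power_moment_1: "power_moment n 1 = 1"
  by (simp add: power_moment_def kloosterman_def zeta_def)

lemma power_moment_prod:
  assumes "finite A" "\<And>p. p \<in> A \<Longrightarrow> f p > 0" "pairwise (\<lambda>p r. coprime (f p) (f r)) A"
  shows "power_moment n (\<Prod>p\<in>A. f p) = (\<Prod>p\<in>A. power_moment n (f p))"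
  using assms
proof (induction A rule: finite_induct)
  case empty
  then show ?case using power_moment_1 by simp
next
  case (insert p A)
  have "coprime (f p) (\<Prod>r\<in>A. f r)"
    using insert.prems(2) insert.hyps by (intro prod_coprime_right) (auto simp: pairwise_insert)
  then have "power_moment n (f p * (\<Prod>r\<in>A. f r)) = power_moment n (f p) * power_moment n (\<Prod>r\<in>A. f r)"
    using insert.prems(1) by (intro power_moment_mult prod_pos) auto
  then show ?case
    using insert by (simp add: pairwise_insert)
qed

section \<open>Stationary phase\<close>

lemma kloosterman_unit_shift:
  assumes "q > 0" "coprime w (int q)"
  shows "kloosterman (u * w) v q = kloosterman u (v * w) q"
proof -
  have "kloosterman_term q (u * w) v x = kloosterman_term q u (v * w) (w * x)" if "x \<in> units q" for x
  proof -
    define w' where "w' = modular_inverse (int q) w"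
    define x' where "x' = modular_inverse (int q) x"
    have w': "[w * w' = 1] (mod int q)" and x': "[x * x' = 1] (mod int q)"
      unfolding w'_def x'_def using assms units_coprime[OF that] by (auto intro: cong_modular_inverse1)
    have "[w * x * (w' * x') = 1] (mod int q)"
      using cong_mult[OF w' x'] by (simp add: mult_ac)
    then have "kloosterman_term q u (v * w) (w * x) = echar q (u * (w * x) + v * w * (w' * x'))"
      by (rule kloosterman_term_witness[OF assms(1)])
    also have "\<dots> = echar q (u * w * x + v * x')"
    proof (rule echar_cong[OF assms(1)])
      have "[u * w * x + v * x' * (w * w') = u * w * x + v * x' * 1] (mod int q)"
        by (intro cong_add cong_mult cong_refl w')
      then show "[u * (w * x) + v * w * (w' * x') = u * w * x + v * x'] (mod int q)"
        by (simp add: mult_ac)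
    qed
    finally show ?thesis
      by (simp add: kloosterman_term_def x'_def)
  qed
  then have "kloosterman (u * w) v q = (\<Sum>x\<in>units q. kloosterman_term q u (v * w) (w * x))"
    using assms(1) by (simp add: kloosterman_eq_sum_units)
  also have "\<dots> = (\<Sum>x\<in>units q. kloosterman_term q u (v * w) x)"
  proof (rule sum_units_reindex[OF assms(1)])
    show "kloosterman_term q u (v * w) x = kloosterman_term q u (v * w) y"
      if "coprime x (int q)" "[x = y] (mod int q)" for x y
      using kloosterman_term_cong[OF assms(1) that] .
  qed (use assms in \<open>auto simp: cong_mult_lcancel\<close>)
  finally show ?thesis
    using assms(1) by (simp add: kloosterman_eq_sum_units)
qed

text \<open>
  Since \<open>q\<close> divides \<open>B\<^sup>2\<close>, the inverse of \<open>1 + B t\<close> is \<open>1 - B t\<close>. The substitution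
  \<open>x \<mapsto> (1 + B t) x\<close> therefore multiplies each term by \<open>e(t B (u x - v / x) / q)\<close> and leaves the
  whole sum unchanged. Averaging over \<open>t\<close> modulo \<open>M\<close> removes every \<open>x\<close> for which \<open>u x - v / x\<close>
  is not divisible by \<open>M\<close>.
\<close>

lemma kloosterman_stationary_phase:
  assumes "q > 0" "q = B * M" "q dvd B ^ 2"
  shows "kloosterman u v q =
    (\<Sum>x | x \<in> units q \<and> int M dvd u * x - v * modular_inverse (int q) x. kloosterman_term q u v x)"
proof -
  define d where "d x = u * x - v * modular_inverse (int q) x" for x
  have pos: "B > 0" "M > 0" using assms(1,2) by auto
  have Bsq: "int q dvd int B * int B"
    using assms(3) by (simp add: power2_eq_square flip: of_nat_mult)
  have shifted: "kloosterman u v q = (\<Sum>x\<in>units q. kloosterman_term q u v x * echar q (t * (int B * d x)))" for t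
  proof -
    have unit: "[(1 + int B * t) * (1 - int B * t) = 1] (mod int q)"
    proof -
      have "(1 + int B * t) * (1 - int B * t) - 1 = int B * int B * (- t\<^sup>2)"
        by (simp add: algebra_simps power2_eq_square)
      with Bsq show ?thesis by (simp add: cong_iff_dvd_diff)
    qed
    then have cop: "coprime (1 + int B * t) (int q)"
      using coprime_iff_invertible_int by blast
    have "kloosterman_term q u v ((1 + int B * t) * x) =
            kloosterman_term q u v x * echar q (t * (int B * d x))" if "x \<in> units q" for x
    proof -
      define x' where "x' = modular_inverse (int q) x"
      have "[x * x' = 1] (mod int q)"
        unfolding x'_def using units_coprime[OF that] by (rule cong_modular_inverse1)
      from cong_mult[OF unit this]
      have "[(1 + int B * t) * x * ((1 - int B * t) * x') = 1] (mod int q)"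
        by (simp add: mult_ac)
      then have "kloosterman_term q u v ((1 + int B * t) * x) =
          echar q (u * ((1 + int B * t) * x) + v * ((1 - int B * t) * x'))"
        by (rule kloosterman_term_witness[OF assms(1)])
      also have "u * ((1 + int B * t) * x) + v * ((1 - int B * t) * x') =
          (u * x + v * x') + t * (int B * d x)"
        by (simp add: d_def x'_def algebra_simps)
      finally show ?thesis
        by (simp only: echar_add kloosterman_term_def x'_def)
    qed
    then have "(\<Sum>x\<in>units q. kloosterman_term q u v x * echar q (t * (int B * d x))) =
        (\<Sum>x\<in>units q. kloosterman_term q u v ((1 + int B * t) * x))"
      by simp
    also have "\<dots> = (\<Sum>x\<in>units q. kloosterman_term q u v x)"
    proof (rule sum_units_reindex[OF assms(1)])
      show "kloosterman_term q u v x = kloosterman_term q u v y"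
        if "coprime x (int q)" "[x = y] (mod int q)" for x y
        using kloosterman_term_cong[OF assms(1) that] .
      show "[x = y] (mod int q)" if "[(1 + int B * t) * x = (1 + int B * t) * y] (mod int q)" for x y
        using that cop by (simp add: cong_mult_lcancel)
      show "coprime ((1 + int B * t) * x) (int q)" if "coprime x (int q)" for x
        using that cop by simp
    qed
    finally show ?thesis
      using assms(1) by (simp add: kloosterman_eq_sum_units)
  qed
  have "of_nat M * kloosterman u v q =
      (\<Sum>t\<in>{0..<int M}. \<Sum>x\<in>units q. kloosterman_term q u v x * echar q (t * (int B * d x)))"
    by (simp flip: shifted)
  also have "\<dots> = (\<Sum>x\<in>units q. kloosterman_term q u v x * (\<Sum>t\<in>{0..<int M}. echar q (t * (int B * d x))))"
    by (subst sum.swap) (simp add: sum_distrib_left)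
  also have "\<dots> = (\<Sum>x\<in>units q. if int M dvd d x then of_nat M * kloosterman_term q u v x else 0)"
  proof (intro sum.cong refl)
    fix x
    have "(\<Sum>t\<in>{0..<int M}. echar q (t * (int B * d x))) =
        (if int q dvd int B * d x then of_int (int M) else 0)"
      by (rule sum_echar_multiples) (use assms pos in auto)
    moreover have "int q dvd int B * d x \<longleftrightarrow> int M dvd d x"
      using pos assms(2) by simp
    ultimately show "kloosterman_term q u v x * (\<Sum>t\<in>{0..<int M}. echar q (t * (int B * d x))) =
        (if int M dvd d x then of_nat M * kloosterman_term q u v x else 0)"
      by simp
  qed
  also have "\<dots> = of_nat M * (\<Sum>x | x \<in> units q \<and> int M dvd d x. kloosterman_term q u v x)"
    by (simp add: sum_distrib_left sum.If_cases Int_def)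
  finally show ?thesis
    using pos by (simp add: d_def)
qed

section \<open>Square roots modulo powers of an odd prime\<close>

text \<open>
  \<open>p\<close> cannot divide both \<open>x - y\<close> and \<open>x + y\<close>, as it would then divide \<open>2 y\<close>. So the power of
  \<open>p\<close> goes entirely into one factor of \<open>x\<^sup>2 - y\<^sup>2\<close>.
\<close>

lemma odd_prime_power_dvd_square_diff:
  fixes x y :: int
  assumes "prime p" "odd p" "\<not> int p dvd y"
  shows "int p ^ k dvd x\<^sup>2 - y\<^sup>2 \<longleftrightarrow> int p ^ k dvd x - y \<or> int p ^ k dvd x + y"
proof
  assume "int p ^ k dvd x\<^sup>2 - y\<^sup>2"
  then have dvd: "int p ^ k dvd (x - y) * (x + y)"
    by (simp add: power2_eq_square algebra_simps)
  have prime: "prime (int p)" using assms(1) by simp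
  have "\<not> (int p dvd x - y \<and> int p dvd x + y)"
  proof
    assume "int p dvd x - y \<and> int p dvd x + y"
    then have "int p dvd (x + y) - (x - y)"
      using dvd_diff by blast
    then have "int p dvd 2 * y" by simp
    then have "int p dvd 2"
      using prime assms(3) prime_dvd_mult_iff by blast
    then have "p dvd 2" by presburger
    then show False
      using assms(1,2) primes_dvd_imp_eq two_is_prime_nat by blast
  qed
  then have "coprime (int p ^ k) (x - y) \<or> coprime (int p ^ k) (x + y)"
    using prime prime_imp_coprime by (metis coprime_power_left_iff)
  with dvd show "int p ^ k dvd x - y \<or> int p ^ k dvd x + y"
    by (auto simp: coprime_dvd_mult_right_iff coprime_dvd_mult_left_iff)
next
  have "x\<^sup>2 - y\<^sup>2 = (x - y) * (x + y)"
    by (simp add: power2_eq_square algebra_simps)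
  then show "int p ^ k dvd x - y \<or> int p ^ k dvd x + y \<Longrightarrow> int p ^ k dvd x\<^sup>2 - y\<^sup>2"
    by auto
qed

text \<open>
  The residues \<open>z \<equiv> 1\<close> modulo \<open>p\<close> form a group of exponent dividing \<open>p ^ k\<close> modulo
  \<open>p ^ (k + 1)\<close>. For odd \<open>p\<close> this exponent is odd, so \<open>z\<close> is the square of
  \<open>z ^ ((p ^ k + 1) / 2)\<close>: an explicit square root, where one would usually lift one by Hensel.
\<close>

lemma power_prime_power_cong_1:
  fixes z :: int
  assumes "[z = 1] (mod int p)"
  shows "[z ^ (p ^ k) = 1] (mod int p ^ Suc k)"
proof (induction k)
  case 0
  then show ?case using assms by simp
next
  case (Suc k)
  define y where "y = z ^ (p ^ k)"
  have y: "int p ^ Suc k dvd y - 1"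
    using Suc.IH by (simp add: y_def cong_iff_dvd_diff)
  then have "[y = 1] (mod int p)"
    by (meson cong_iff_dvd_diff dvd_power dvd_trans zero_less_Suc)
  then have "[(\<Sum>i<p. y ^ i) = (\<Sum>i<p. 1 ^ i)] (mod int p)"
    by (intro cong_sum cong_pow)
  then have "int p dvd (\<Sum>i<p. y ^ i)"
    by (simp add: cong_dvd_iff)
  with y have "int p ^ Suc k * int p dvd (y - 1) * (\<Sum>i<p. y ^ i)"
    by (rule mult_dvd_mono)
  then have "int p ^ Suc (Suc k) dvd y ^ p - 1"
    by (simp add: power_diff_1_eq mult_ac)
  then show ?case
    by (simp add: y_def cong_iff_dvd_diff mult.commute flip: power_mult)
qed

section \<open>Evaluation modulo a power of an odd prime\<close>

lemma sum_residues_shift: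
  fixes f :: "int \<Rightarrow> complex"
  assumes "N > 0" "\<And>x. f (x mod N) = f x"
  shows "(\<Sum>s\<in>{0..<N}. f (s + t)) = (\<Sum>s\<in>{0..<N}. f s)"
proof -
  have "(\<Sum>s\<in>{0..<N}. f ((s + t) mod N)) = (\<Sum>s\<in>{0..<N}. f s)"
    by (rule sum.reindex_bij_witness[of _ "\<lambda>s. (s - t) mod N" "\<lambda>s. (s + t) mod N"])
       (use assms(1) in \<open>auto simp: mod_simps\<close>)
  then show ?thesis by (simp add: assms(2))
qed

lemma binomial_double: "h > 0 \<Longrightarrow> (2 * h) choose h = 2 * ((2 * h - 1) choose (h - 1))"
proof -
  assume "h > 0"
  then obtain j where h: "h = Suc j" by (cases h) auto
  have "(2 * j + 1) choose Suc j = (2 * j + 1) choose j"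
    using binomial_symmetric[of "Suc j" "2 * j + 1"] by simp
  then show ?thesis by (simp add: h)
qed

locale odd_prime_power =
  fixes p a :: nat
  assumes prime: "prime p" and odd: "odd p" and a: "a \<ge> 2"
begin

abbreviation "q \<equiv> p ^ a"
abbreviation "m \<equiv> a div 2"
abbreviation "N \<equiv> p ^ (a - m)"

lemma q_pos: "q > 0" and p_pos: "p > 0" and prime_int: "prime (int p)"
  using prime by (simp_all add: prime_gt_0_nat)

lemma coprime_q_iff: "coprime x (int q) \<longleftrightarrow> \<not> int p dvd x"
proof -
  have "coprime (int p) x \<longleftrightarrow> \<not> int p dvd x"
    using prime_int by (metis coprime_absorb_left not_prime_unit prime_imp_coprime)
  then show ?thesis using a by (simp add: coprime_commute)
qed

lemma N_mult: "q = N * p ^ m"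
  by (simp flip: power_add)

text \<open>
  Stationary phase with \<open>B = p ^ (a - m)\<close> and \<open>M = p ^ m\<close>; rounding \<open>m\<close> down is what makes
  \<open>q\<close> divide \<open>B\<^sup>2\<close>.
\<close>

lemma kloosterman_critical:
  "kloosterman u v q =
    (\<Sum>x | x \<in> units q \<and> int p ^ m dvd u * x - v * modular_inverse (int q) x. kloosterman_term q u v x)"
proof -
  have "q dvd N ^ 2"
    by (simp flip: power_mult) (rule le_imp_power_dvd, simp)
  from kloosterman_stationary_phase[OF q_pos N_mult this] show ?thesis
    by (simp only: of_nat_power)
qed

text \<open>
  For \<open>u = v\<close> the critical points of \<open>K(v, v; q)\<close> are \<open>1\<close> and \<open>-1\<close> modulo \<open>p ^ m\<close>;
  \<open>branch\<close> collects the terms near \<open>1\<close>.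
\<close>

definition branch :: "int \<Rightarrow> complex" where
  "branch v = (\<Sum>x | x \<in> units q \<and> int p ^ m dvd x - 1. kloosterman_term q v v x)"

text \<open>
  The factor \<open>p ^ (2 m)\<close> is \<open>q\<close> for even \<open>a\<close>, when all terms are \<open>1\<close>, and \<open>q / p\<close> for odd
  \<open>a\<close>, when this is a multiple of the quadratic Gauss sum modulo \<open>p\<close>. Keeping both cases in one
  formula avoids distinguishing them.
\<close>

definition gauss_sum :: "int \<Rightarrow> complex" where
  "gauss_sum v = (\<Sum>s\<in>{0..<int N}. echar q (v * (int p ^ (2 * m) * s\<^sup>2)))"

text \<open>
  Put \<open>x = 1 + p ^ m s\<close>. Modulo \<open>q\<close> the geometric series for \<open>1 / x\<close> stops after the quadratic
  term, because \<open>a \<le> 3 m\<close>, and in \<open>x + 1 / x\<close> the linear terms cancel.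
\<close>

lemma branch_eq: "branch v = echar q (2 * v) * gauss_sum v"
proof -
  have m: "m \<ge> 1" using a by auto
  have "{x. x \<in> units q \<and> int p ^ m dvd x - 1} = (\<lambda>s. 1 + int p ^ m * s) ` {0..<int N}"
  proof (intro equalityI subsetI)
    fix x assume "x \<in> {x. x \<in> units q \<and> int p ^ m dvd x - 1}"
    then obtain s where s: "x - 1 = int p ^ m * s" and x: "x \<in> units q"
      by auto
    have "x \<noteq> 0"
      using units_coprime[OF x] unfolding coprime_q_iff by auto
    moreover have "int q = int p ^ m * int N"
      by (simp flip: power_add)
    then have "0 \<le> x" "x < int p ^ m * int N"
      using x unfolding units_def by auto
    ultimately have "0 < x" "x < int p ^ m * int N" by auto
    with s have "0 \<le> int p ^ m * s" "int p ^ m * s < int p ^ m * int N" by linarith+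
    moreover have "int p ^ m > 0" using p_pos by simp
    ultimately have "s \<in> {0..<int N}"
      by (auto simp: zero_le_mult_iff)
    with s show "x \<in> (\<lambda>s. 1 + int p ^ m * s) ` {0..<int N}"
      by (intro image_eqI[of _ _ s]) auto
  next
    fix x assume "x \<in> (\<lambda>s. 1 + int p ^ m * s) ` {0..<int N}"
    then obtain s where s: "0 \<le> s" "s < int N" "x = 1 + int p ^ m * s" by auto
    have "int p dvd int p ^ m" using m by (simp add: dvd_power)
    then have "\<not> int p dvd x"
      using s(3) prime_int by (metis dvd_add_left_iff dvd_mult2 not_prime_unit)
    moreover have "x < int q"
    proof -
      have "int p ^ m > 1"
        using prime_gt_1_int[OF prime_int] m by (intro one_less_power) auto
      moreover have "int p ^ m * (s + 1) \<le> int p ^ m * int N"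
        using s by (intro mult_left_mono) auto
      moreover have "int q = int p ^ m * int N"
        using N_mult by (simp flip: power_add)
      ultimately show ?thesis using s(3) by (simp add: algebra_simps)
    qed
    ultimately show "x \<in> {x. x \<in> units q \<and> int p ^ m dvd x - 1}"
      using s by (simp add: units_def coprime_q_iff del: of_nat_power)
  qed
  moreover have "inj_on (\<lambda>s. 1 + int p ^ m * s) {0..<int N}"
    using p_pos by (intro inj_onI) auto
  ultimately have "branch v = (\<Sum>s\<in>{0..<int N}. kloosterman_term q v v (1 + int p ^ m * s))"
    by (simp add: branch_def sum.reindex)
  also have "\<dots> = (\<Sum>s\<in>{0..<int N}. echar q (2 * v) * echar q (v * (int p ^ (2 * m) * s\<^sup>2)))"
  proof (intro sum.cong refl)
    fix s
    \<comment> \<open>the truncated geometric series for the inverse of \<open>1 + p ^ m s\<close>\<close>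
    define w where "w = 1 - int p ^ m * s + int p ^ (2 * m) * s\<^sup>2"
    have "int p ^ (2 * m) = (int p ^ m)\<^sup>2" "int p ^ (3 * m) = (int p ^ m) ^ 3"
      by (simp_all add: mult.commute flip: power_mult)
    then have "(1 + int p ^ m * s) * w - 1 = int p ^ (3 * m) * s ^ 3"
      by (simp add: w_def algebra_simps power2_eq_square power3_eq_cube)
    moreover have "int q dvd int p ^ (3 * m)"
      using m by (simp add: le_imp_power_dvd)
    ultimately have "[(1 + int p ^ m * s) * w = 1] (mod int q)"
      by (simp add: cong_iff_dvd_diff)
    then have "kloosterman_term q v v (1 + int p ^ m * s) = echar q (v * (1 + int p ^ m * s) + v * w)"
      by (rule kloosterman_term_witness[OF q_pos])
    also have "v * (1 + int p ^ m * s) + v * w = 2 * v + v * (int p ^ (2 * m) * s\<^sup>2)"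
      by (simp add: w_def algebra_simps)
    finally show "kloosterman_term q v v (1 + int p ^ m * s) =
        echar q (2 * v) * echar q (v * (int p ^ (2 * m) * s\<^sup>2))"
      by (simp only: echar_add)
  qed
  finally show ?thesis
    by (simp add: gauss_sum_def sum_distrib_left)
qed

text \<open>
  The substitution \<open>x \<mapsto> -x\<close> exchanges the branches and conjugates every term.
\<close>

lemma opposite_branch:
  "(\<Sum>x | x \<in> units q \<and> int p ^ m dvd x + 1. kloosterman_term q v v x) = cnj (branch v)"
proof -
  \<comment> \<open>extension by zero to all units, where the substitution is a permutation\<close>
  define f where "f x = (if int p ^ m dvd x + 1 then kloosterman_term q v v x else 0)" for x
  have "(\<Sum>x | x \<in> units q \<and> int p ^ m dvd x + 1. kloosterman_term q v v x) = (\<Sum>x\<in>units q. f x)"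
    by (simp add: f_def sum.If_cases Int_def)
  also have "\<dots> = (\<Sum>x\<in>units q. f (- x))"
  proof (rule sum_units_reindex[OF q_pos, symmetric])
    fix x y assume "coprime x (int q)" and xy: "[x = y] (mod int q)"
    have "[x = y] (mod int p ^ m)"
      by (rule cong_dvd_modulus[OF xy]) (simp add: le_imp_power_dvd)
    then have "int p ^ m dvd x + 1 \<longleftrightarrow> int p ^ m dvd y + 1"
      by (intro cong_dvd_iff cong_add cong_refl)
    then show "f x = f y"
      using kloosterman_term_cong[OF q_pos \<open>coprime x (int q)\<close> xy] by (simp add: f_def)
  next
    show "[x = y] (mod int q)" if "[- x = - y] (mod int q)" for x y
      using that cong_minus_minus_iff by blast
  qed auto
  also have "\<dots> = (\<Sum>x\<in>units q. if int p ^ m dvd x - 1 then cnj (kloosterman_term q v v x) else 0)"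
  proof (intro sum.cong refl)
    fix x assume "x \<in> units q"
    then have "[x * modular_inverse (int q) x = 1] (mod int q)"
      using units_coprime cong_modular_inverse1 by blast
    then have "kloosterman_term q v v (- x) = echar q (v * (- x) + v * (- modular_inverse (int q) x))"
      by (intro kloosterman_term_witness[OF q_pos]) simp
    also have "\<dots> = cnj (kloosterman_term q v v x)"
      by (simp only: kloosterman_term_def cnj_echar) (simp add: algebra_simps)
    finally have "kloosterman_term q v v (- x) = cnj (kloosterman_term q v v x)" .
    moreover have "int p ^ m dvd - x + 1 \<longleftrightarrow> int p ^ m dvd x - 1"
      using dvd_minus_iff[of "int p ^ m" "x - 1"] by simp
    ultimately show "f (- x) = (if int p ^ m dvd x - 1 then cnj (kloosterman_term q v v x) else 0)"
      by (simp add: f_def)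
  qed
  also have "\<dots> = cnj (branch v)"
    by (simp add: branch_def sum.If_cases Int_def)
  finally show ?thesis .
qed

text \<open>
  Rescaling \<open>x\<close> by \<open>v\<close> turns \<open>K(v\<^sup>2, 1; q)\<close> into the symmetric sum \<open>K(v, v; q)\<close>, whose critical
  points satisfy \<open>x\<^sup>2 \<equiv> 1\<close> whatever \<open>v\<close> is.
\<close>

lemma kloosterman_square:
  assumes "coprime v (int q)"
  shows "kloosterman (v\<^sup>2) 1 q = branch v + cnj (branch v)"
proof -
  have m: "m \<ge> 1" using a by auto
  have critical: "int p ^ m dvd v * x - v * modular_inverse (int q) x \<longleftrightarrow>
      int p ^ m dvd x - 1 \<or> int p ^ m dvd x + 1" if "x \<in> units q" for x
  proof -
    define x' where "x' = modular_inverse (int q) x"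
    have cop: "coprime (int p ^ m) v" "coprime (int p ^ m) x"
      using assms units_coprime[OF that] a by (simp_all add: coprime_commute)
    have "[x * x' = 1] (mod int q)"
      unfolding x'_def using units_coprime[OF that] by (rule cong_modular_inverse1)
    then have "[x * x' = 1] (mod int p ^ m)"
      by (rule cong_dvd_modulus) (simp add: le_imp_power_dvd)
    then have "[x * x - x * x' = x\<^sup>2 - 1\<^sup>2] (mod int p ^ m)"
      unfolding power2_eq_square by (intro cong_diff) auto
    then have "int p ^ m dvd x * (x - x') \<longleftrightarrow> int p ^ m dvd x\<^sup>2 - 1\<^sup>2"
      by (simp add: cong_dvd_iff right_diff_distrib)
    also have "\<dots> \<longleftrightarrow> int p ^ m dvd x - 1 \<or> int p ^ m dvd x + 1"
      using prime_int by (intro odd_prime_power_dvd_square_diff prime odd) auto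
    finally show ?thesis
      using cop by (simp add: x'_def coprime_dvd_mult_right_iff flip: right_diff_distrib)
  qed
  have exclusive: "\<not> (int p ^ m dvd x - 1 \<and> int p ^ m dvd x + 1)" for x
  proof
    assume "int p ^ m dvd x - 1 \<and> int p ^ m dvd x + 1"
    then have "int p ^ m dvd (x + 1) - (x - 1)"
      using dvd_diff by blast
    moreover have "int p dvd int p ^ m" using m by (simp add: dvd_power)
    ultimately have "int p dvd 2" by (simp add: dvd_trans)
    then have "p dvd 2" by presburger
    then show False
      using prime odd primes_dvd_imp_eq two_is_prime_nat by blast
  qed
  have "kloosterman (v\<^sup>2) 1 q = kloosterman v v q"
    using kloosterman_unit_shift[OF q_pos assms, of v 1] by (simp add: power2_eq_square)
  also have "\<dots> = (\<Sum>x | x \<in> units q \<and> int p ^ m dvd v * x - v * modular_inverse (int q) x.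
      kloosterman_term q v v x)"
    by (rule kloosterman_critical)
  also have "{x. x \<in> units q \<and> int p ^ m dvd v * x - v * modular_inverse (int q) x} =
      {x. x \<in> units q \<and> int p ^ m dvd x - 1} \<union> {x. x \<in> units q \<and> int p ^ m dvd x + 1}"
    using critical by auto
  also have "sum (kloosterman_term q v v) \<dots> =
      branch v + (\<Sum>x | x \<in> units q \<and> int p ^ m dvd x + 1. kloosterman_term q v v x)"
    unfolding branch_def using exclusive by (intro sum.union_disjoint) auto
  finally show ?thesis
    by (simp add: opposite_branch)
qed

text \<open>
  Weyl differencing: in the double sum for \<open>g(v) cnj g(v)\<close> replace one variable by its
  difference \<open>s\<close> to the other variable \<open>t\<close>. The exponent becomes linear in \<open>t\<close>, and the
  sum over \<open>t\<close> keeps only the \<open>s\<close> divisible by \<open>p ^ (a - 2 m)\<close>, for which the remaining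
  phase is trivial. There are \<open>p ^ m\<close> of these, each with weight \<open>p ^ (a - m)\<close>.
\<close>

lemma gauss_sum_norm:
  assumes "coprime v (int q)"
  shows "gauss_sum v * cnj (gauss_sum v) = of_nat q"
proof -
  define P where "P = int p ^ (2 * m)"
  have NP: "int q dvd int N * P"
    by (simp add: P_def le_imp_power_dvd flip: power_add)
  have split: "echar q (v * (P * (s + t)\<^sup>2)) * cnj (echar q (v * (P * t\<^sup>2))) =
      echar q (v * (P * s\<^sup>2)) * echar q (t * (2 * v * P * s))" for s t
    by (simp only: cnj_echar flip: echar_add) (simp add: algebra_simps power2_eq_square)
  have shift: "(\<Sum>s\<in>{0..<int N}. echar q (v * (P * (s + t)\<^sup>2))) = (\<Sum>s\<in>{0..<int N}. echar q (v * (P * s\<^sup>2)))" for t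
  proof (rule sum_residues_shift)
    show "int N > 0" using p_pos by simp
    fix x
    define y where "y = x mod int N"
    have "[y = x] (mod int N)" by (simp add: y_def cong_def)
    then have "int N dvd y\<^sup>2 - x\<^sup>2"
      using cong_pow cong_iff_dvd_diff by blast
    then have "int N * P dvd (y\<^sup>2 - x\<^sup>2) * P"
      by (rule mult_dvd_mono) simp
    then have "int q dvd v * ((y\<^sup>2 - x\<^sup>2) * P)"
      by (rule dvd_mult[OF dvd_trans[OF NP]])
    then have "[v * (P * y\<^sup>2) = v * (P * x\<^sup>2)] (mod int q)"
      by (simp add: cong_iff_dvd_diff algebra_simps del: of_nat_power)
    then show "echar q (v * (P * (x mod int N)\<^sup>2)) = echar q (v * (P * x\<^sup>2))"
      unfolding y_def by (rule echar_cong[OF q_pos])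
  qed
  have "gauss_sum v * cnj (gauss_sum v) =
      (\<Sum>t\<in>{0..<int N}. (\<Sum>s\<in>{0..<int N}. echar q (v * (P * s\<^sup>2))) * cnj (echar q (v * (P * t\<^sup>2))))"
    by (simp only: gauss_sum_def P_def cnj_sum sum_distrib_left)
  also have "\<dots> = (\<Sum>t\<in>{0..<int N}. (\<Sum>s\<in>{0..<int N}. echar q (v * (P * (s + t)\<^sup>2))) * cnj (echar q (v * (P * t\<^sup>2))))"
    by (simp only: shift)
  also have "\<dots> = (\<Sum>t\<in>{0..<int N}. \<Sum>s\<in>{0..<int N}. echar q (v * (P * s\<^sup>2)) * echar q (t * (2 * v * P * s)))"
    by (simp only: sum_distrib_right split)
  also have "\<dots> = (\<Sum>s\<in>{0..<int N}. echar q (v * (P * s\<^sup>2)) * (\<Sum>t\<in>{0..<int N}. echar q (t * (2 * v * P * s))))"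
    by (subst sum.swap) (simp only: sum_distrib_left)
  also have "\<dots> = (\<Sum>s\<in>{0..<int N}. if int p ^ (a - 2 * m) dvd s then of_nat N else 0)"
  proof (intro sum.cong refl)
    fix s
    have "coprime (int q) (2 * v)"
      using assms odd by (simp add: coprime_commute)
    then have "int q dvd 2 * v * P * s \<longleftrightarrow> int q dvd P * s"
      by (simp add: coprime_dvd_mult_right_iff mult.assoc)
    also have "\<dots> \<longleftrightarrow> P * int p ^ (a - 2 * m) dvd P * s"
      by (simp add: P_def flip: power_add)
    also have "\<dots> \<longleftrightarrow> int p ^ (a - 2 * m) dvd s"
      using p_pos by (simp add: P_def)
    finally have iff: "int q dvd 2 * v * P * s \<longleftrightarrow> int p ^ (a - 2 * m) dvd s" .
    have inner: "(\<Sum>t\<in>{0..<int N}. echar q (t * (2 * v * P * s))) =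
        (if int q dvd 2 * v * P * s then of_int (int N) else 0)"
    proof (rule sum_echar_multiples[OF _ q_pos])
      have "int q dvd (int N * P) * (2 * v * s)" using NP by (rule dvd_mult2)
      then show "int q dvd int N * (2 * v * P * s)" by (simp add: mult_ac)
    qed (use p_pos in simp)
    have "echar q (v * (P * s\<^sup>2)) = 1" if "int p ^ (a - 2 * m) dvd s"
    proof -
      have "P * int p ^ (a - 2 * m) dvd P * s"
        using that by (rule mult_dvd_mono[OF dvd_refl])
      then have "int q dvd P * s"
        by (simp add: P_def flip: power_add)
      then have "int q dvd (P * s) * (v * s)" by (rule dvd_mult2)
      then show ?thesis
        by (simp add: echar_eq_1_iff[OF q_pos] power2_eq_square mult_ac del: of_nat_power)
    qed
    then show "echar q (v * (P * s\<^sup>2)) * (\<Sum>t\<in>{0..<int N}. echar q (t * (2 * v * P * s))) =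
        (if int p ^ (a - 2 * m) dvd s then of_nat N else 0)"
      unfolding inner iff by simp
  qed
  also have "\<dots> = of_nat (card {s \<in> {0..<int N}. int p ^ (a - 2 * m) dvd s}) * of_nat N"
    by (simp add: sum.If_cases Int_def)
  also have "card {s \<in> {0..<int N}. int p ^ (a - 2 * m) dvd s} = p ^ m"
  proof -
    have N: "int N = int p ^ (a - 2 * m) * int p ^ m"
      by (simp flip: power_add)
    have "bij_betw (\<lambda>i. c * i) {0..<M} {s \<in> {0..<c * M}. c dvd s}" if "c > 0" for c M :: int
      unfolding bij_betw_def using that
      by (auto simp: inj_on_def zero_le_mult_iff elim!: dvdE)
    from this[of "int p ^ (a - 2 * m)" "int p ^ m"]
    have "bij_betw (\<lambda>i. int p ^ (a - 2 * m) * i) {0..<int p ^ m} {s \<in> {0..<int N}. int p ^ (a - 2 * m) dvd s}"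
      unfolding N using p_pos by simp
    then have "card {s \<in> {0..<int N}. int p ^ (a - 2 * m) dvd s} = card {0..<int p ^ m}"
      by (rule bij_betw_same_card[symmetric])
    then show ?thesis
      by (simp del: of_nat_power add: nat_power_eq)
  qed
  also have "of_nat (p ^ m) * of_nat N = (of_nat q :: complex)"
    by (simp flip: power_add)
  finally show ?thesis .
qed

lemma gauss_sum_periodic: "gauss_sum (v + int p) = gauss_sum v"
  unfolding gauss_sum_def
proof (intro sum.cong refl echar_cong[OF q_pos])
  fix s
  have "int q dvd int p ^ Suc (2 * m)"
    by (simp add: le_imp_power_dvd del: power_Suc)
  then have "int q dvd int p ^ Suc (2 * m) * s\<^sup>2" by (rule dvd_mult2)
  then show "[(v + int p) * (int p ^ (2 * m) * s\<^sup>2) = v * (int p ^ (2 * m) * s\<^sup>2)] (mod int q)"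
    by (simp add: cong_iff_dvd_diff algebra_simps)
qed

section \<open>The moment for a prime power\<close>

text \<open>
  Translation by \<open>p\<close> permutes the units modulo \<open>q\<close> and multiplies the sum by \<open>e(p c / q) \<noteq> 1\<close>.
\<close>

lemma twisted_sum_eq_0:
  fixes h :: "int \<Rightarrow> complex"
  assumes "\<And>v. h (v + int p) = h v" "\<And>v w. [v = w] (mod int q) \<Longrightarrow> h v = h w" "\<not> int q dvd int p * c"
  shows "(\<Sum>v\<in>units q. echar q (v * c) * h v) = 0"
proof -
  let ?f = "\<lambda>v. echar q (v * c) * h v"
  have "(\<Sum>v\<in>units q. ?f v) = (\<Sum>v\<in>units q. ?f (v + int p))"
  proof (rule sum_units_reindex[OF q_pos, symmetric])
    show "?f v = ?f w" if "[v = w] (mod int q)" for v w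
      using that assms(2) echar_cong[OF q_pos cong_mult[OF that cong_refl]] by simp
    show "coprime (v + int p) (int q)" if "coprime v (int q)" for v
      using that by (simp add: coprime_q_iff del: of_nat_power)
    show "[v = w] (mod int q)" if "[v + int p = w + int p] (mod int q)" for v w
      using that by (simp add: cong_add_rcancel)
  qed
  also have "\<dots> = echar q (int p * c) * (\<Sum>v\<in>units q. ?f v)"
    unfolding distrib_right echar_add assms(1) sum_distrib_left by (simp only: mult_ac)
  finally show ?thesis
    using assms(3) by (simp add: echar_eq_1_iff[OF q_pos] del: of_nat_power)
qed

lemma gauss_sum_cong: "[v = w] (mod int q) \<Longrightarrow> gauss_sum v = gauss_sum w"
  unfolding gauss_sum_def by (intro sum.cong refl echar_cong[OF q_pos] cong_mult cong_refl)

text \<open>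
  The bound on \<open>h\<close> is used for the off-diagonal binomial terms: it makes \<open>p ^ (a - 1)\<close> too large
  to divide \<open>k - h\<close> for any \<open>k \<noteq> h\<close> between \<open>0\<close> and \<open>2 h\<close>.
\<close>

lemma sum_units_branch_power:
  assumes "0 < h" "h < p ^ (a - 1)"
  shows "(\<Sum>v\<in>units q. (branch v + cnj (branch v)) ^ (2 * h)) =
           of_nat ((2 * h) choose h) * of_nat q ^ h * of_nat (totient q)"
proof -
  let ?n = "2 * h"
  define G where "G k v = gauss_sum v ^ k * cnj (gauss_sum v) ^ (?n - k)" for k v
  have expand: "branch v ^ k * cnj (branch v) ^ (?n - k) =
      echar q (v * (4 * (int k - int h))) * G k v" if "k \<le> ?n" for v k
  proof -
    have "echar q (2 * v) ^ k * cnj (echar q (2 * v)) ^ (?n - k) =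
        echar q (2 * v * int k + - (2 * v) * int (?n - k))"
      by (simp only: cnj_echar power_int_power' echar_add)
    also have "2 * v * int k + - (2 * v) * int (?n - k) = v * (4 * (int k - int h))"
      using that by (simp add: of_nat_diff algebra_simps)
    finally show ?thesis
      by (simp add: branch_eq G_def power_mult_distrib mult_ac)
  qed
  have moment: "(\<Sum>v\<in>units q. branch v ^ k * cnj (branch v) ^ (?n - k)) =
      (if k = h then of_nat q ^ h * of_nat (totient q) else 0)" if k: "k \<le> ?n" for k
  proof (cases "k = h")
    case True
    have "branch v ^ k * cnj (branch v) ^ (?n - k) = of_nat q ^ h" if "v \<in> units q" for v
      using expand[OF k, of v] gauss_sum_norm[OF units_coprime[OF that]] True
      by (simp add: G_def flip: power_mult_distrib)
    then show ?thesis using True by (simp add: card_units)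
  next
    case False
    have "\<not> int q dvd int p * (4 * (int k - int h))"
    proof
      have q: "int q = int p * int p ^ (a - 1)"
        using a by (simp flip: power_Suc)
      assume "int q dvd int p * (4 * (int k - int h))"
      then have "int p ^ (a - 1) dvd 2 ^ 2 * (int k - int h)"
        unfolding q using p_pos by simp
      moreover have "coprime (int p ^ (a - 1)) (2 ^ 2)"
        using odd unfolding coprime_power_left_iff coprime_power_right_iff by simp
      ultimately have dvd: "int p ^ (a - 1) dvd int k - int h"
        by (simp only: coprime_dvd_mult_right_iff)
      have "\<bar>int k - int h\<bar> < int p ^ (a - 1)"
        using k assms(2) by (simp flip: of_nat_power)
      then show False
        using dvd False dvd_imp_le_int[of "int k - int h" "int p ^ (a - 1)"] by simp
    qed
    then have "(\<Sum>v\<in>units q. echar q (v * (4 * (int k - int h))) * G k v) = 0"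
      by (intro twisted_sum_eq_0) (auto simp: G_def gauss_sum_periodic simp del: of_nat_power dest: gauss_sum_cong)
    then show ?thesis
      using False expand[OF k] by simp
  qed
  have "(\<Sum>v\<in>units q. (branch v + cnj (branch v)) ^ ?n) =
      (\<Sum>v\<in>units q. \<Sum>k\<le>?n. of_nat (?n choose k) * (branch v ^ k * cnj (branch v) ^ (?n - k)))"
    by (simp add: binomial_ring mult_ac)
  also have "\<dots> = (\<Sum>k\<le>?n. of_nat (?n choose k) * (\<Sum>v\<in>units q. branch v ^ k * cnj (branch v) ^ (?n - k)))"
    by (subst sum.swap) (simp only: sum_distrib_left)
  also have "\<dots> = (\<Sum>k\<le>?n. if k = h then of_nat (?n choose h) * (of_nat q ^ h * of_nat (totient q)) else 0)"
    by (intro sum.cong refl) (simp add: moment)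
  also have "\<dots> = of_nat (?n choose h) * of_nat q ^ h * of_nat (totient q)"
    by (simp add: mult.assoc)
  finally show ?thesis .
qed

text \<open>
  A nonzero sum has a critical point \<open>x\<close>, and \<open>z = u x\<^sup>2\<close> is \<open>1\<close> modulo \<open>p\<close>. Such a \<open>z\<close> is a
  square because its multiplicative order is odd, hence so is \<open>u = z / x\<^sup>2\<close>.
\<close>

lemma kloosterman_nonzero_imp_square:
  assumes "kloosterman u 1 q \<noteq> 0"
  obtains v where "coprime v (int q)" "[v\<^sup>2 = u] (mod int q)"
proof -
  have m: "m \<ge> 1" using a by auto
  from assms obtain x where x: "x \<in> units q" "int p ^ m dvd u * x - 1 * modular_inverse (int q) x"
    unfolding kloosterman_critical by (metis (no_types, lifting) mem_Collect_eq sum.neutral)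
  define x' where "x' = modular_inverse (int q) x"
  have x': "[x * x' = 1] (mod int q)"
    unfolding x'_def using units_coprime[OF x(1)] by (rule cong_modular_inverse1)
  define z where "z = u * x\<^sup>2"
  have pq: "int p dvd int q" "int p dvd int p ^ m" using a m by (simp_all add: dvd_power)
  have z: "[z = 1] (mod int p)"
  proof -
    have "int p dvd u * x - x'"
      using x(2) pq(2) dvd_trans by (auto simp: x'_def)
    then have "[x * (u * x) = x * x'] (mod int p)"
      by (intro cong_mult cong_refl) (simp add: cong_iff_dvd_diff)
    also have "[x * x' = 1] (mod int p)"
      by (rule cong_dvd_modulus[OF x' pq(1)])
    finally show ?thesis
      by (simp add: z_def power2_eq_square mult_ac)
  qed
  define e where "e = (p ^ (a - 1) + 1) div 2"
  have e: "2 * e = p ^ (a - 1) + 1"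
    using odd by (simp add: e_def)
  have root: "[z ^ (p ^ (a - 1)) = 1] (mod int q)"
    using power_prime_power_cong_1[OF z, of "a - 1"] a by simp
  show ?thesis
  proof (rule that)
    have "\<not> int p dvd z"
      using z prime_int by (metis cong_dvd_iff not_prime_unit)
    then have "coprime z (int q)" by (simp add: coprime_q_iff del: of_nat_power)
    moreover have "coprime x' (int q)"
      using x' coprime_iff_invertible_int by (metis mult.commute)
    ultimately show "coprime (x' * z ^ e) (int q)"
      by (intro coprime_mult_left_iff[THEN iffD2] conjI coprime_power_left_iff[THEN iffD2] disjI1)
    have "(x' * z ^ e)\<^sup>2 = x'\<^sup>2 * (z ^ (p ^ (a - 1)) * z)"
      by (simp only: power_mult_distrib power_mult[symmetric] mult.commute[of e] e power_add power_one_right)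
    also have "[\<dots> = x'\<^sup>2 * (1 * z)] (mod int q)"
      by (intro cong_mult cong_refl root)
    also have "x'\<^sup>2 * (1 * z) = u * (x * x')\<^sup>2"
      by (simp add: z_def power_mult_distrib)
    also have "[\<dots> = u * 1\<^sup>2] (mod int q)"
      by (intro cong_mult cong_refl cong_pow x')
    finally show "[(x' * z ^ e)\<^sup>2 = u] (mod int q)" by simp
  qed
qed

lemma card_square_roots:
  assumes "coprime v (int q)"
  shows "card {w \<in> units q. w\<^sup>2 mod int q = v\<^sup>2 mod int q} = 2"
proof -
  have nd: "\<not> int p dvd v" using assms by (simp add: coprime_q_iff del: of_nat_power)
  have "{w \<in> units q. w\<^sup>2 mod int q = v\<^sup>2 mod int q} = {v mod int q, (- v) mod int q}"
  proof (intro equalityI subsetI)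
    fix w assume w: "w \<in> {w \<in> units q. w\<^sup>2 mod int q = v\<^sup>2 mod int q}"
    then have "int p ^ a dvd w\<^sup>2 - v\<^sup>2"
      by (simp add: mod_eq_dvd_iff)
    then have "int q dvd w - v \<or> int q dvd w - (- v)"
      using odd_prime_power_dvd_square_diff[OF prime odd nd, of a w] by simp
    then have "w mod int q = v mod int q \<or> w mod int q = (- v) mod int q"
      by (simp only: mod_eq_dvd_iff)
    moreover have "w mod int q = w"
      using w by (simp add: units_def)
    ultimately show "w \<in> {v mod int q, (- v) mod int q}" by auto
  next
    fix w assume "w \<in> {v mod int q, (- v) mod int q}"
    then obtain c where c: "c = v \<or> c = - v" "w = c mod int q" by auto
    then have "coprime c (int q)" "c\<^sup>2 = v\<^sup>2" using assms by auto
    then show "w \<in> {w \<in> units q. w\<^sup>2 mod int q = v\<^sup>2 mod int q}"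
      using c(2) mod_in_units[OF q_pos, of c] by (simp add: power_mod del: of_nat_power)
  qed
  moreover have "v mod int q \<noteq> (- v) mod int q"
  proof
    assume "v mod int q = (- v) mod int q"
    then have "int q dvd 2 * v" by (simp only: mod_eq_dvd_iff) simp
    moreover have "int p dvd int q" using a by simp
    ultimately have "int p dvd 2 * v" using dvd_trans by blast
    then have "int p dvd 2" using prime_int nd prime_dvd_mult_iff by blast
    then have "p dvd 2" by presburger
    then show False
      using prime odd primes_dvd_imp_eq two_is_prime_nat by blast
  qed
  ultimately show ?thesis by simp
qed

text \<open>
  Sorting the units \<open>v\<close> by \<open>v\<^sup>2\<close> counts each \<open>u\<close> with \<open>K(u, 1; q) \<noteq> 0\<close> exactly twice. The other \<open>u\<close>
  contribute zero to both sides, however many square roots they have.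
\<close>

lemma double_power_moment:
  assumes "n > 0"
  shows "2 * power_moment n q = (\<Sum>v\<in>units q. kloosterman (v\<^sup>2) 1 q ^ n)"
proof -
  have "(\<Sum>v\<in>units q. kloosterman (v\<^sup>2) 1 q ^ n) = (\<Sum>v\<in>units q. kloosterman (v\<^sup>2 mod int q) 1 q ^ n)"
    by (intro sum.cong refl arg_cong[where f = "\<lambda>z. z ^ n"] kloosterman_cong[OF q_pos]) (simp add: cong_def)
  also have "\<dots> = (\<Sum>u\<in>{0..<int q}. \<Sum>v | v \<in> units q \<and> v\<^sup>2 mod int q = u. kloosterman (v\<^sup>2 mod int q) 1 q ^ n)"
    using q_pos by (intro sum.group[symmetric]) (auto simp del: of_nat_power)
  also have "\<dots> = (\<Sum>u\<in>{0..<int q}. 2 * kloosterman u 1 q ^ n)"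
  proof (intro sum.cong refl)
    fix u assume u: "u \<in> {0..<int q}"
    let ?R = "{v. v \<in> units q \<and> v\<^sup>2 mod int q = u}"
    have "(\<Sum>v\<in>?R. kloosterman (v\<^sup>2 mod int q) 1 q ^ n) = of_nat (card ?R) * kloosterman u 1 q ^ n"
      by simp
    also have "\<dots> = 2 * kloosterman u 1 q ^ n"
    proof (cases "kloosterman u 1 q = 0")
      case True
      then show ?thesis using assms by simp
    next
      case False
      then obtain v where v: "coprime v (int q)" "[v\<^sup>2 = u] (mod int q)"
        by (rule kloosterman_nonzero_imp_square)
      then have "u = v\<^sup>2 mod int q" using u by (simp add: cong_def)
      then show ?thesis using card_square_roots[OF v(1)] by simp
    qed
    finally show "(\<Sum>v\<in>?R. kloosterman (v\<^sup>2 mod int q) 1 q ^ n) = 2 * kloosterman u 1 q ^ n" .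
  qed
  finally show ?thesis
    by (simp add: power_moment_residues[OF q_pos] sum_distrib_left)
qed

lemma power_moment_prime_power:
  assumes "0 < h" "h < p ^ (a - 1)"
  shows "power_moment (2 * h) q =
    of_real (real ((2 * h - 1) choose (h - 1)) * ((real p - 1) / real p) * real p ^ ((h + 1) * a))"
proof -
  have "2 * power_moment (2 * h) q = (\<Sum>v\<in>units q. (branch v + cnj (branch v)) ^ (2 * h))"
    using assms(1) double_power_moment[of "2 * h"]
    by (simp add: kloosterman_square[OF units_coprime])
  also have "\<dots> = 2 * of_real (real ((2 * h - 1) choose (h - 1)) * real q ^ h * real (totient q))"
    unfolding sum_units_branch_power[OF assms] binomial_double[OF assms(1)] by simp
  also have "real (totient q) = real p ^ (a - 1) * (real p - 1)"
    using a p_pos by (simp add: totient_prime_power[OF prime] of_nat_diff)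
  also have "real ((2 * h - 1) choose (h - 1)) * real q ^ h * (real p ^ (a - 1) * (real p - 1)) =
      real ((2 * h - 1) choose (h - 1)) * ((real p - 1) / real p) * real p ^ ((h + 1) * a)"
  proof -
    have "real p ^ ((h + 1) * a) = real q ^ h * (real p ^ (a - 1) * real p)"
      using a by (simp add: distrib_right power_add mult.commute flip: power_mult power_Suc)
    then show ?thesis using p_pos by simp
  qed
  finally show ?thesis
    by (simp only: mult_cancel_left) simp
qed

end

section \<open>The moment for odd moduli\<close>

theorem theorem2:
  fixes n q :: nat
  assumes "n \<ge> 2" and "even n"
    and "q \<ge> 3" and "odd q"
    and "\<And>p. p \<in> prime_factors q \<Longrightarrow>
           real (multiplicity p q) > log (real p) (real n / 2) + 1"
  shows "power_moment n q =
           of_real (\<Prod>p\<in>prime_factors q.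
             real ((n - 1) choose (n div 2 - 1)) * ((real p - 1) / real p) *
             real p ^ ((n div 2 + 1) * multiplicity p q))"
proof -
  define h where "h = n div 2"
  have h: "n = 2 * h" "h > 0" using assms(1,2) by (auto simp: h_def)
  have prime_power: "power_moment n (p ^ multiplicity p q) =
      of_real (real ((n - 1) choose (n div 2 - 1)) * ((real p - 1) / real p) *
             real p ^ ((n div 2 + 1) * multiplicity p q))" if p: "p \<in> prime_factors q" for p
  proof -
    define a where "a = multiplicity p q"
    have prime: "prime p" and "p dvd q" using p by (auto simp: in_prime_factors_iff)
    then have "odd p" using assms(4) by auto
    have p1: "real p > 1" using prime_gt_1_nat[OF prime] by simp
    have log: "log (real p) (real h) + 1 < real a"
      using assms(5)[OF p] h by (simp add: a_def)
    moreover have "log (real p) (real h) \<ge> 0"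
      using p1 h(2) by simp
    ultimately have "a \<ge> 2" by linarith
    then have "log (real p) (real h) < real (a - 1)"
      using log by simp
    then have "real h < real p ^ (a - 1)"
      using p1 h(2) by (simp add: log_less_iff powr_realpow)
    then have "h < p ^ (a - 1)"
      by (simp flip: of_nat_power)
    interpret odd_prime_power p a
      by unfold_locales fact+
    show ?thesis
      using power_moment_prime_power[OF h(2) \<open>h < p ^ (a - 1)\<close>] by (simp add: h(1) a_def)
  qed
  have "q = (\<Prod>p\<in>prime_factors q. p ^ multiplicity p q)"
    using assms(3) by (intro prime_factorization_nat) simp
  then have "power_moment n q = power_moment n (\<Prod>p\<in>prime_factors q. p ^ multiplicity p q)"
    by simp
  also have "\<dots> = (\<Prod>p\<in>prime_factors q. power_moment n (p ^ multiplicity p q))"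
  proof (rule power_moment_prod)
    show "pairwise (\<lambda>p r. coprime (p ^ multiplicity p q) (r ^ multiplicity r q)) (prime_factors q)"
      by (auto simp: pairwise_def in_prime_factors_iff primes_coprime)
    show "p ^ multiplicity p q > 0" if "p \<in> prime_factors q" for p
      using that by (auto simp: in_prime_factors_iff prime_gt_0_nat)
  qed simp
  finally show ?thesis
    by (simp add: prime_power)
qed

end
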